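(* Let $f$ be chosen uniformly at random from $F(n)$. The probability that there exists $h\in F(n)$ with $h\sim f$ such that $\mathcal{A}(h)$ has at least $0.046\cdot 2^n$ attractors, each of size at most $4$, tends to $1$ as $n\to\infty$.
   Context: $F(n)$ is the set of all functions $f:\{0,1\}^n\to\{0,1\}^n$, written $f=(f_1,\dots,f_n)$. $e_i$ is the configuration with a $1$ exactly in component $i$; addition is componentwise modulo $2$. The asynchronous graph $\mathcal{A}(f)$ is the digraph on $\{0,1\}^n$ with an arc from $x$ to $x+e_i$ whenever $f_i(x)\neq x_i$. An attractor is an inclusion-minimal non-empty set $X\subseteq\{0,1\}^n$ with no arc from $X$ to its complement. $\mathcal{S}(f)$ has an arc $x\to f(x)$ for every $x$; $f\sim h$ means $\mathcal{S}(f)$ and $\mathcal{S}(h)$ are isomorphic. *)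

theory Defs
  imports "HOL-Probability.Probability"
begin

text \<open>Configurations in \<open>{0,1}\<^sup>n\<close> are Boolean lists of length \<open>n\<close>;
  components are indexed by \<open>0, \<dots>, n - 1\<close>.\<close>

definition configs :: "nat \<Rightarrow> bool list set" where
  "configs n = {x. length x = n}"

definition unit_config :: "nat \<Rightarrow> nat \<Rightarrow> bool list" where
  "unit_config n i = map (\<lambda>j. j = i) [0..<n]"

definition add_config :: "bool list \<Rightarrow> bool list \<Rightarrow> bool list" where
  "add_config x y = map2 (\<noteq>) x y"

text \<open>Extensional functions, so that each map on \<open>configs n\<close> is represented exactly once
  and the uniform distribution on \<open>boolean_networks n\<close> is the intended one.\<close>

definition boolean_networks :: "nat \<Rightarrow> (bool list \<Rightarrow> bool list) set" where
  "boolean_networks n = configs n \<rightarrow>\<^sub>E configs n"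

definition async_arcs :: "nat \<Rightarrow> (bool list \<Rightarrow> bool list) \<Rightarrow> (bool list \<times> bool list) set" where
  "async_arcs n f =
     {(x, add_config x (unit_config n i)) | x i. x \<in> configs n \<and> i < n \<and> f x ! i \<noteq> x ! i}"

definition sync_arcs :: "nat \<Rightarrow> (bool list \<Rightarrow> bool list) \<Rightarrow> (bool list \<times> bool list) set" where
  "sync_arcs n f = {(x, f x) | x. x \<in> configs n}"

definition closed_set :: "'a set \<Rightarrow> ('a \<times> 'a) set \<Rightarrow> 'a set \<Rightarrow> bool" where
  "closed_set V E X \<longleftrightarrow> X \<noteq> {} \<and> X \<subseteq> V \<and> \<not> (\<exists>x\<in>X. \<exists>y\<in>V - X. (x, y) \<in> E)"

definition is_attractor :: "'a set \<Rightarrow> ('a \<times> 'a) set \<Rightarrow> 'a set \<Rightarrow> bool" where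
  "is_attractor V E X \<longleftrightarrow>
     closed_set V E X \<and> (\<forall>Y. closed_set V E Y \<and> Y \<subseteq> X \<longrightarrow> Y = X)"

definition digraph_isomorphic ::
  "'a set \<Rightarrow> ('a \<times> 'a) set \<Rightarrow> 'b set \<Rightarrow> ('b \<times> 'b) set \<Rightarrow> bool" where
  "digraph_isomorphic V E W D \<longleftrightarrow>
     (\<exists>p. bij_betw p V W \<and> (\<forall>x\<in>V. \<forall>y\<in>V. (x, y) \<in> E \<longleftrightarrow> (p x, p y) \<in> D))"

definition sync_equiv ::
  "nat \<Rightarrow> (bool list \<Rightarrow> bool list) \<Rightarrow> (bool list \<Rightarrow> bool list) \<Rightarrow> bool" where
  "sync_equiv n f h \<longleftrightarrow>
     digraph_isomorphic (configs n) (sync_arcs n f) (configs n) (sync_arcs n h)"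

lemma finite_configs: "finite (configs n)"
  using finite_lists_length_eq[of "UNIV :: bool set" n] by (simp add: configs_def)

lemma finite_boolean_networks: "finite (boolean_networks n)"
  by (simp add: boolean_networks_def finite_PiE finite_configs)

lemma boolean_networks_nonempty: "boolean_networks n \<noteq> {}"
proof -
  have "replicate n False \<in> configs n" by (simp add: configs_def)
  then show ?thesis by (auto simp: boolean_networks_def PiE_eq_empty_iff)
qed

end

theory Submission
  imports Defs
begin

text \<open>
  If \<open>a \<noteq> b\<close>, \<open>f a = f b = u\<close> and \<open>f u = v\<close>, call \<open>v\<close> a tip and relabel \<open>u, a, b, v\<close> as the corners
  \<open>00w, 10w, 01w, 11w\<close> of a square. In the asynchronous graph \<open>u\<close> then only moves to \<open>a\<close> or \<open>b\<close>, and
  these only move back to \<open>u\<close>, so \<open>{u, a, b}\<close> is closed and contains an attractor. Disjoint such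
  quadruples can be relabelled simultaneously.

  The quadruples of two tips \<open>v \<noteq> v'\<close> can only overlap if one of the tips is \<open>f\<close> or
  \<open>f \<circ> f\<close> of the other. These relations form a graph of average degree at most \<open>4\<close>
  on every subset of tips, so a fifth of all tips have pairwise disjoint quadruples.

  For random \<open>f\<close>, the preimages of \<open>v\<close> and their own in-degrees behave like independent
  Poisson(1) variables, so the expected proportion of tips tends to
  \<open>1 - exp (2 / e - 1) = 0.2322\<dots> > 5 \<cdot> 0.046\<close>. Changing one value of \<open>f\<close> changes the number of
  tips by at most \<open>2\<close>, so its variance is at most \<open>4 \<cdot> 2\<^sup>n\<close> and Chebyshev's inequality applies.
\<close>

section \<open>Concentration for functionals of a uniformly random map\<close>

lemma sum_PiE_insert:
  assumes "x \<notin> V"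
  shows "(\<Sum>f\<in>insert x V \<rightarrow>\<^sub>E C. F f) = (\<Sum>g\<in>V \<rightarrow>\<^sub>E C. \<Sum>y\<in>C. F (g(x := y)))"
proof -
  have "inj_on (\<lambda>(y, g). g(x := y)) (C \<times> (V \<rightarrow>\<^sub>E C))"
    using inj_combinator[OF assms, of "\<lambda>_. C"] by simp
  then have "(\<Sum>f\<in>insert x V \<rightarrow>\<^sub>E C. F f) = (\<Sum>(y, g)\<in>C \<times> (V \<rightarrow>\<^sub>E C). F (g(x := y)))"
    by (simp add: PiE_insert_eq sum.reindex case_prod_unfold)
  also have "\<dots> = (\<Sum>y\<in>C. \<Sum>g\<in>V \<rightarrow>\<^sub>E C. F (g(x := y)))"
    by (simp add: sum.cartesian_product)
  also have "\<dots> = (\<Sum>g\<in>V \<rightarrow>\<^sub>E C. \<Sum>y\<in>C. F (g(x := y)))"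
    by (rule sum.swap)
  finally show ?thesis .
qed

text \<open>An Efron--Stein type bound, by averaging out one coordinate at a time.\<close>

lemma variance_PiE_le:
  fixes X :: "('a \<Rightarrow> 'b) \<Rightarrow> real" and \<mu> :: real
  assumes "finite V" and C: "finite C" "C \<noteq> {}"
    and lip: "\<And>f x y. f \<in> V \<rightarrow>\<^sub>E C \<Longrightarrow> x \<in> V \<Longrightarrow> y \<in> C \<Longrightarrow> \<bar>X (f(x := y)) - X f\<bar> \<le> c"
    and mean: "(\<Sum>f\<in>V \<rightarrow>\<^sub>E C. X f) = \<mu> * card (V \<rightarrow>\<^sub>E C)"
  shows "(\<Sum>f\<in>V \<rightarrow>\<^sub>E C. (X f - \<mu>)\<^sup>2) \<le> c\<^sup>2 * card V * card (V \<rightarrow>\<^sub>E C)"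
  using \<open>finite V\<close> lip mean
proof (induction V arbitrary: X rule: finite_induct)
  case empty
  then show ?case by simp
next
  case (insert x V)
  let ?F = "V \<rightarrow>\<^sub>E C"
  define K where "K = real (card C)"
  have K: "K > 0" using C by (simp add: K_def card_gt_0_iff)
  \<comment> \<open>\<open>Y\<close> is the conditional mean of \<open>X\<close> once the value at
    \<open>x\<close> is averaged out. It inherits both the mean and the Lipschitz constant of
    \<open>X\<close>, so the induction hypothesis applies to it.\<close>
  define Y where "Y g = (\<Sum>y\<in>C. X (g(x := y))) / K" for g
  have card_insert: "real (card (insert x V \<rightarrow>\<^sub>E C)) = K * card ?F"
    using insert.hyps by (simp add: card_PiE K_def)
  have sumY: "(\<Sum>y\<in>C. X (g(x := y))) = K * Y g" for g
    using K by (simp add: Y_def)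
  have in_F: "g(x := y) \<in> insert x V \<rightarrow>\<^sub>E C" if "g \<in> ?F" "y \<in> C" for g y
    using that by (auto simp: PiE_insert_eq)
  have lipY: "\<bar>Y (g(z := y)) - Y g\<bar> \<le> c" if "g \<in> ?F" "z \<in> V" "y \<in> C" for g z y
  proof -
    have "z \<noteq> x" using that insert.hyps by auto
    have "\<bar>\<Sum>w\<in>C. X (g(z := y, x := w)) - X (g(x := w))\<bar>
        \<le> (\<Sum>w\<in>C. \<bar>X (g(x := w, z := y)) - X (g(x := w))\<bar>)"
      using \<open>z \<noteq> x\<close> by (simp add: fun_upd_twist[of z x] sum_abs)
    also have "\<dots> \<le> (\<Sum>w\<in>C. c)"
      by (intro sum_mono insert.prems in_F) (use that in auto)
    finally have "\<bar>K * Y (g(z := y)) - K * Y g\<bar> \<le> K * c"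
      by (simp add: sum_subtractf sumY K_def)
    then show ?thesis
      using K by (simp add: right_diff_distrib[symmetric] abs_mult)
  qed
  have meanY: "(\<Sum>g\<in>?F. Y g) = \<mu> * card ?F"
  proof -
    have "K * (\<Sum>g\<in>?F. Y g) = (\<Sum>f\<in>insert x V \<rightarrow>\<^sub>E C. X f)"
      using insert.hyps by (simp add: sum_PiE_insert sumY sum_distrib_left)
    also have "\<dots> = K * (\<mu> * card ?F)"
      using insert.prems(2) by (simp add: card_insert)
    finally show ?thesis using K by simp
  qed
  \<comment> \<open>The square is split around the fibre mean \<open>Y g\<close>, so the cross term
    sums to zero. Values in one fibre differ pairwise by at most \<open>c\<close>, hence also from
    their mean.\<close>
  have fibre: "(\<Sum>y\<in>C. (X (g(x := y)) - \<mu>)\<^sup>2) \<le> K * c\<^sup>2 + K * (Y g - \<mu>)\<^sup>2"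
    if g: "g \<in> ?F" for g
  proof -
    have dev: "\<bar>X (g(x := y)) - Y g\<bar> \<le> c" if y: "y \<in> C" for y
    proof -
      have "\<bar>\<Sum>w\<in>C. X (g(x := y)) - X (g(x := w))\<bar>
          \<le> (\<Sum>w\<in>C. \<bar>X (g(x := w, x := y)) - X (g(x := w))\<bar>)"
        by (simp add: sum_abs)
      also have "\<dots> \<le> (\<Sum>w\<in>C. c)"
        by (intro sum_mono insert.prems in_F) (use g y in auto)
      finally have "\<bar>K * X (g(x := y)) - K * Y g\<bar> \<le> K * c"
        by (simp add: sum_subtractf sumY K_def)
      then show ?thesis
        using K by (simp add: right_diff_distrib[symmetric] abs_mult)
    qed
    have "(\<Sum>y\<in>C. (X (g(x := y)) - \<mu>)\<^sup>2)
        = (\<Sum>y\<in>C. (X (g(x := y)) - Y g)\<^sup>2 + 2 * (Y g - \<mu>) * (X (g(x := y)) - Y g) + (Y g - \<mu>)\<^sup>2)"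
      by (intro sum.cong) (auto simp: power2_eq_square algebra_simps)
    also have "\<dots> = (\<Sum>y\<in>C. (X (g(x := y)) - Y g)\<^sup>2) + 2 * (Y g - \<mu>) * (K * Y g - K * Y g)
        + K * (Y g - \<mu>)\<^sup>2"
      by (simp only: sum.distrib sum_distrib_left[symmetric] sum_subtractf sumY sum_constant K_def)
    also have "(\<Sum>y\<in>C. (X (g(x := y)) - Y g)\<^sup>2) \<le> (\<Sum>y\<in>C. c\<^sup>2)"
      using dev by (intro sum_mono) (metis abs_ge_self abs_le_square_iff order_trans)
    finally show ?thesis by (simp add: K_def)
  qed
  have "(\<Sum>f\<in>insert x V \<rightarrow>\<^sub>E C. (X f - \<mu>)\<^sup>2) \<le> (\<Sum>g\<in>?F. K * c\<^sup>2 + K * (Y g - \<mu>)\<^sup>2)"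
    unfolding sum_PiE_insert[OF insert.hyps(2)] by (intro sum_mono fibre)
  also have "\<dots> = K * (c\<^sup>2 * card ?F + (\<Sum>g\<in>?F. (Y g - \<mu>)\<^sup>2))"
    by (simp add: sum.distrib sum_distrib_left algebra_simps)
  also have "\<dots> \<le> K * (c\<^sup>2 * card ?F + c\<^sup>2 * card V * card ?F)"
    using K insert.IH[OF lipY meanY] by simp
  also have "\<dots> = c\<^sup>2 * card (insert x V) * card (insert x V \<rightarrow>\<^sub>E C)"
    using insert.hyps unfolding card_insert by (simp add: algebra_simps)
  finally show ?case .
qed

text \<open>One-sided Chebyshev, stated in counts. A lower bound on the mean suffices:
  \<open>X f < t\<close> puts \<open>X f\<close> at least \<open>d\<close> below the true mean,
  whatever that is.\<close>

lemma low_tail_PiE_card_le: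
  fixes X :: "('a \<Rightarrow> 'b) \<Rightarrow> real" and t d :: real
  assumes "finite V" and C: "finite C" "C \<noteq> {}"
    and lip: "\<And>f x y. f \<in> V \<rightarrow>\<^sub>E C \<Longrightarrow> x \<in> V \<Longrightarrow> y \<in> C \<Longrightarrow> \<bar>X (f(x := y)) - X f\<bar> \<le> c"
    and mean: "(t + d) * card (V \<rightarrow>\<^sub>E C) \<le> (\<Sum>f\<in>V \<rightarrow>\<^sub>E C. X f)" and "0 < d"
  shows "card {f \<in> V \<rightarrow>\<^sub>E C. X f < t} * d\<^sup>2 \<le> c\<^sup>2 * card V * card (V \<rightarrow>\<^sub>E C)"
proof -
  let ?F = "V \<rightarrow>\<^sub>E C"
  have fin: "finite ?F" using assms by (simp add: finite_PiE)
  have "?F \<noteq> {}" using C by (simp add: PiE_eq_empty_iff)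
  then have pos: "0 < real (card ?F)" using fin by (simp add: card_gt_0_iff)
  define \<mu> where "\<mu> = (\<Sum>f\<in>?F. X f) / card ?F"
  have "t + d \<le> \<mu>" using mean pos by (simp add: \<mu>_def le_divide_eq)
  have "card {f \<in> ?F. X f < t} * d\<^sup>2 = (\<Sum>f\<in>{f \<in> ?F. X f < t}. d\<^sup>2)"
    by simp
  also have "\<dots> \<le> (\<Sum>f\<in>{f \<in> ?F. X f < t}. (X f - \<mu>)\<^sup>2)"
    using \<open>t + d \<le> \<mu>\<close> \<open>0 < d\<close> by (intro sum_mono) (auto simp: abs_le_square_iff[symmetric])
  also have "\<dots> \<le> (\<Sum>f\<in>?F. (X f - \<mu>)\<^sup>2)"
    using fin by (intro sum_mono2) auto
  also have "\<dots> \<le> c\<^sup>2 * card V * card ?F"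
    using variance_PiE_le[OF \<open>finite V\<close> C lip, where \<mu> = \<mu>] pos by (simp add: \<mu>_def)
  finally show ?thesis .
qed

section \<open>Tips, and the choice of pairwise compatible ones\<close>

text \<open>Greedy choice. Each point has at most two out-neighbours under \<open>f\<close> and
  \<open>f o f\<close>, so some \<open>w\<close> in \<open>W\<close> has at most two in-neighbours.
  Keeping \<open>w\<close> costs at most five points: \<open>w\<close>, its out-neighbours and its
  in-neighbours.\<close>

lemma sparse_subset_functional_graph:
  fixes f :: "'a \<Rightarrow> 'a"
  assumes "finite W"
  shows "\<exists>I\<subseteq>W. card W \<le> 5 * card I \<and> (\<forall>x\<in>I. \<forall>y\<in>I. x \<noteq> y \<longrightarrow> y \<noteq> f x \<and> y \<noteq> f (f x))"
  using assms
proof (induction W rule: finite_psubset_induct)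
  case (psubset W)
  show ?case
  proof (cases "W = {}")
    case False
    define pre where "pre w = {x \<in> W. f x = w \<or> f (f x) = w}" for w
    have "(\<Sum>w\<in>W. card (pre w)) = (\<Sum>w\<in>W. \<Sum>x\<in>W. if f x = w \<or> f (f x) = w then 1 else 0)"
      using psubset.hyps by (simp add: pre_def sum.If_cases Int_def)
    also have "\<dots> = (\<Sum>x\<in>W. \<Sum>w\<in>W. if f x = w \<or> f (f x) = w then 1 else 0)"
      by (rule sum.swap)
    also have "\<dots> \<le> (\<Sum>x\<in>W. 2)"
    proof (rule sum_mono)
      fix x
      have "(\<Sum>w\<in>W. if f x = w \<or> f (f x) = w then 1 else 0) = card (W \<inter> {w. f x = w \<or> f (f x) = w})"
        using psubset.hyps by (simp add: sum.If_cases)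
      also have "\<dots> \<le> card {f x, f (f x)}"
        by (intro card_mono) auto
      also have "\<dots> \<le> 2"
        by (simp add: card_insert_if)
      finally show "(\<Sum>w\<in>W. if f x = w \<or> f (f x) = w then 1 else 0) \<le> (2::nat)" .
    qed
    finally have le: "(\<Sum>w\<in>W. card (pre w)) \<le> 2 * card W"
      by simp
    obtain w where w: "w \<in> W" "card (pre w) \<le> 2"
    proof (rule ccontr)
      assume "\<not> thesis"
      with that have "\<not> card (pre w) \<le> 2" if "w \<in> W" for w
        using that by blast
      then have "\<forall>w\<in>W. 3 \<le> card (pre w)"
        by (simp add: not_le Suc_le_eq[symmetric] numeral_eq_Suc)
      then have "(\<Sum>w\<in>W. 3) \<le> (\<Sum>w\<in>W. card (pre w))"
        by (intro sum_mono) auto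
      moreover have "0 < card W" using False psubset.hyps by (simp add: card_gt_0_iff)
      ultimately show False using le by simp
    qed
    define J where "J = {w, f w, f (f w)} \<union> pre w"
    have "finite J" using psubset.hyps by (simp add: J_def pre_def)
    have "card J \<le> card {w, f w, f (f w)} + card (pre w)"
      unfolding J_def by (rule card_Un_le)
    also have "\<dots> \<le> 5"
      using w(2) by (auto simp: card_insert_if)
    finally have "card J \<le> 5" .
    have "W - J \<subset> W" using w by (auto simp: J_def)
    from psubset.IH[OF this] obtain I where I: "I \<subseteq> W - J" "card (W - J) \<le> 5 * card I"
      "\<forall>x\<in>I. \<forall>y\<in>I. x \<noteq> y \<longrightarrow> y \<noteq> f x \<and> y \<noteq> f (f x)"
      by blast
    have "finite I" using I(1) psubset.hyps by (meson finite_Diff finite_subset)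
    have "w \<notin> I" using I(1) by (auto simp: J_def)
    have "card W \<le> card (W - J) + card J"
      using \<open>finite J\<close> by (metis add.commute diff_card_le_card_Diff le_diff_conv)
    also have "\<dots> \<le> 5 * card (insert w I)"
      using I(2) \<open>card J \<le> 5\<close> \<open>finite I\<close> \<open>w \<notin> I\<close> by simp
    finally have "card W \<le> 5 * card (insert w I)" .
    moreover have "insert w I \<subseteq> W" using I(1) w by auto
    moreover have "\<forall>x\<in>insert w I. \<forall>y\<in>insert w I. x \<noteq> y \<longrightarrow> y \<noteq> f x \<and> y \<noteq> f (f x)"
      using I(1,3) by (auto simp: J_def pre_def)
    ultimately show ?thesis by blast
  qed auto
qed

definition forked :: "'a set \<Rightarrow> ('a \<Rightarrow> 'a) \<Rightarrow> 'a set" where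
  "forked V f = {v \<in> V. \<exists>a\<in>V. \<exists>b\<in>V. \<exists>u\<in>V. f a = u \<and> f b = u \<and> f u = v \<and> distinct [a, b, u, v]}"

text \<open>A witness \<open>a, b, u\<close> for \<open>v\<close> that avoids \<open>x\<close>
  survives the update. Otherwise \<open>v\<close> is \<open>f x\<close> (if \<open>x = u\<close>) or
  \<open>f (f x)\<close> (if \<open>x\<close> is \<open>a\<close> or \<open>b\<close>).\<close>

lemma forked_fun_upd_subset:
  "forked V f \<subseteq> forked V (f(x := y)) \<union> {f x, f (f x)}"
proof
  fix v assume "v \<in> forked V f"
  then obtain a b u where v: "v \<in> V" "a \<in> V" "b \<in> V" "u \<in> V" "f a = u" "f b = u" "f u = v"
    "distinct [a, b, u, v]"
    unfolding forked_def by blast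
  show "v \<in> forked V (f(x := y)) \<union> {f x, f (f x)}"
  proof (cases "x \<in> {a, b, u}")
    case False
    then have "v \<in> forked V (f(x := y))"
      unfolding forked_def using v by (intro CollectI conjI bexI[of _ a] bexI[of _ b] bexI[of _ u]) auto
    then show ?thesis by simp
  qed (use v in auto)
qed

lemma card_forked_fun_upd:
  assumes "finite V"
  shows "\<bar>real (card (forked V (f(x := y)))) - real (card (forked V f))\<bar> \<le> 2"
proof -
  have le: "card (forked V g) \<le> card (forked V (g(x := z))) + 2" for g z
  proof -
    have "forked V (g(x := z)) \<subseteq> V" by (auto simp: forked_def)
    then have fin: "finite (forked V (g(x := z)))" using assms finite_subset by blast
    have "card (forked V g) \<le> card (forked V (g(x := z)) \<union> {g x, g (g x)})"
      using fin by (intro card_mono forked_fun_upd_subset) auto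
    also have "\<dots> \<le> card (forked V (g(x := z))) + card {g x, g (g x)}"
      by (rule card_Un_le)
    also have "\<dots> \<le> card (forked V (g(x := z))) + 2"
      by (simp add: card_insert_if)
    finally show ?thesis .
  qed
  \<comment> \<open>Undoing an update is itself an update, so the bound on lost tips also bounds the
    gained ones.\<close>
  show ?thesis
    using le[of f y] le[of "f(x := y)" "f x"] by simp
qed

section \<open>Relabelling tips into squares with small attractors\<close>

text \<open>The complements of the two images have equal size in the finite set \<open>S\<close>.
  This turns a relabelling of the selected quadruples into one of all configurations.\<close>

lemma bij_betw_extend:
  assumes "finite S" "inj_on P Z" "inj_on Q Z" "P ` Z \<subseteq> S" "Q ` Z \<subseteq> S"
  obtains p where "bij_betw p S S" "\<And>z. z \<in> Z \<Longrightarrow> p (P z) = Q z"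
proof -
  have fin: "finite (P ` Z)" "finite (Q ` Z)" using assms finite_subset by blast+
  have "card (S - P ` Z) = card (S - Q ` Z)"
    using assms fin by (simp add: card_Diff_subset card_image)
  then obtain r where r: "bij_betw r (S - P ` Z) (S - Q ` Z)"
    using assms(1) finite_same_card_bij[of "S - P ` Z" "S - Q ` Z"] by auto
  define p where "p x = (if x \<in> P ` Z then Q (inv_into Z P x) else r x)" for x
  have PQ: "p (P z) = Q z" if "z \<in> Z" for z
    using that assms(2) by (simp add: p_def)
  have "bij_betw p (P ` Z) (Q ` Z)"
  proof (rule bij_betw_imageI)
    show "inj_on p (P ` Z)" using assms(3) PQ by (auto simp: inj_on_def)
    show "p ` P ` Z = Q ` Z" using PQ by (auto simp: image_iff)
  qed
  moreover have "bij_betw p (S - P ` Z) (S - Q ` Z)"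
    using r by (subst bij_betw_cong[of _ _ r]) (auto simp: p_def)
  ultimately have "bij_betw p (P ` Z \<union> (S - P ` Z)) (Q ` Z \<union> (S - Q ` Z))"
    by (rule bij_betw_combine) auto
  moreover have "P ` Z \<union> (S - P ` Z) = S" "Q ` Z \<union> (S - Q ` Z) = S"
    using assms by auto
  ultimately show thesis using that PQ by auto
qed

lemma closed_set_contains_attractor:
  assumes "finite X" "closed_set V E X"
  shows "\<exists>Y\<subseteq>X. is_attractor V E Y"
  using assms
proof (induction X rule: finite_psubset_induct)
  case (psubset X)
  show ?case
  proof (cases "is_attractor V E X")
    case False
    with psubset.prems obtain Y where Y: "closed_set V E Y" "Y \<subset> X"
      unfolding is_attractor_def by blast
    from psubset.IH[OF Y(2,1)] Y(2) show ?thesis by auto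
  qed auto
qed

text \<open>Attractors are non-empty, so those found inside disjoint closed sets are
  distinct.\<close>

lemma card_attractors_ge:
  assumes fin: "finite V"
    and closed: "\<And>v. v \<in> I \<Longrightarrow> closed_set V E (X v)"
    and disj: "\<And>v w. v \<in> I \<Longrightarrow> w \<in> I \<Longrightarrow> v \<noteq> w \<Longrightarrow> X v \<inter> X w = {}"
    and small: "\<And>v. v \<in> I \<Longrightarrow> card (X v) \<le> k"
  shows "card I \<le> card {Y. is_attractor V E Y \<and> card Y \<le> k}"
proof -
  have sub: "X v \<subseteq> V" if "v \<in> I" for v using closed[OF that] by (simp add: closed_set_def)
  have "\<exists>Y\<subseteq>X v. is_attractor V E Y" if "v \<in> I" for v
    using closed_set_contains_attractor[OF finite_subset[OF sub[OF that] fin] closed[OF that]] .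
  then obtain Y where Y: "\<And>v. v \<in> I \<Longrightarrow> Y v \<subseteq> X v" "\<And>v. v \<in> I \<Longrightarrow> is_attractor V E (Y v)"
    by metis
  have ne: "Y v \<noteq> {}" if "v \<in> I" for v
    using Y(2)[OF that] by (simp add: is_attractor_def closed_set_def)
  have "inj_on Y I"
  proof (rule inj_onI)
    fix v w assume vw: "v \<in> I" "w \<in> I" "Y v = Y w"
    show "v = w"
    proof (rule ccontr)
      assume "v \<noteq> w"
      then show False using disj[OF vw(1,2)] Y(1)[OF vw(1)] Y(1)[OF vw(2)] vw(3) ne[OF vw(1)] by blast
    qed
  qed
  moreover have "card (Y v) \<le> k" if "v \<in> I" for v
    using card_mono[OF finite_subset[OF sub[OF that] fin] Y(1)[OF that]] small[OF that] by simp
  then have "Y ` I \<subseteq> {Y. is_attractor V E Y \<and> card Y \<le> k}" using Y by auto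
  moreover have "{Y. is_attractor V E Y \<and> card Y \<le> k} \<subseteq> Pow V"
    by (auto simp: is_attractor_def closed_set_def)
  then have "finite {Y. is_attractor V E Y \<and> card Y \<le> k}"
    using fin by (meson finite_Pow_iff finite_subset)
  ultimately show ?thesis by (metis card_inj_on_le)
qed

lemma card_configs: "card (configs n) = 2 ^ n"
  using card_lists_length_eq[of "UNIV :: bool set" n] by (simp add: configs_def)

lemma add_unit_config:
  assumes "length x = n" "i < n"
  shows "add_config x (unit_config n i) = x[i := \<not> x ! i]"
  using assms by (intro nth_equalityI) (auto simp: add_config_def unit_config_def nth_list_update)

text \<open>Since \<open>h\<close> preserves the tail \<open>w\<close> here, only the first two
  components can flip, and only one of them at a time.\<close>

lemma async_arc_out_of_square:
  assumes "(s # t # w, y) \<in> async_arcs n h" "h (s # t # w) = s' # t' # w"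
  shows "s \<noteq> s' \<and> y = s' # t # w \<or> t \<noteq> t' \<and> y = s # t' # w"
proof -
  from assms(1) obtain i where len: "length (s # t # w) = n" and i: "i < n"
    "h (s # t # w) ! i \<noteq> (s # t # w) ! i" "y = add_config (s # t # w) (unit_config n i)"
    unfolding async_arcs_def configs_def by blast
  have y: "y = (s # t # w)[i := \<not> (s # t # w) ! i]"
    using add_unit_config[OF len i(1)] i(3) by simp
  have "i < 2"
    using i(2) assms(2) by (auto simp: nth_Cons split: nat.splits)
  then consider "i = 0" | "i = 1" by linarith
  then show ?thesis using i(2) y assms(2) by cases auto
qed

text \<open>Take \<open>h\<close> to be \<open>f\<close> conjugated by \<open>p\<close>; the inverse
  of \<open>p\<close> is the isomorphism from \<open>h\<close> to \<open>f\<close>.\<close>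

lemma conjugate_network:
  assumes f: "f \<in> boolean_networks n" and p: "bij_betw p (configs n) (configs n)"
  obtains h where "h \<in> boolean_networks n" "sync_equiv n h f"
    "\<And>x. x \<in> configs n \<Longrightarrow> h (p x) = p (f x)"
proof
  let ?V = "configs n"
  define q where "q = inv_into ?V p"
  define h where "h = restrict (\<lambda>x. p (f (q x))) ?V"
  have q: "bij_betw q ?V ?V" unfolding q_def using p by (rule bij_betw_inv_into)
  have qp: "q (p x) = x" if "x \<in> ?V" for x
    using that p unfolding q_def by (meson bij_betw_inv_into_left)
  have pq: "p (q x) = x" if "x \<in> ?V" for x
    using that p unfolding q_def by (meson bij_betw_inv_into_right)
  have fV: "f x \<in> ?V" if "x \<in> ?V" for x using f that by (auto simp: boolean_networks_def)
  have pV: "p x \<in> ?V" if "x \<in> ?V" for x using p that by (auto simp: bij_betw_def)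
  have qV: "q x \<in> ?V" if "x \<in> ?V" for x using q that by (auto simp: bij_betw_def)
  show "h \<in> boolean_networks n"
    using fV pV qV by (auto simp: h_def boolean_networks_def)
  show "h (p x) = p (f x)" if "x \<in> ?V" for x
    using that pV qp by (simp add: h_def)
  have "(x, y) \<in> sync_arcs n h \<longleftrightarrow> (q x, q y) \<in> sync_arcs n f" if "x \<in> ?V" "y \<in> ?V" for x y
  proof -
    have "y = p (f (q x)) \<longleftrightarrow> q y = f (q x)"
      using that by (metis fV pq qV qp)
    then show ?thesis using that qV by (auto simp: sync_arcs_def h_def)
  qed
  then show "sync_equiv n h f"
    unfolding sync_equiv_def digraph_isomorphic_def using q by blast
qed

lemma exists_equivalent_many_attractors:
  assumes f: "f \<in> boolean_networks n" and n: "2 \<le> n"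
  shows "\<exists>h\<in>boolean_networks n. sync_equiv n h f \<and>
    card (forked (configs n) f)
      \<le> 5 * card {X. is_attractor (configs n) (async_arcs n h) X \<and> card X \<le> 4}"
proof -
  let ?V = "configs n"
  have "forked ?V f \<subseteq> ?V" by (auto simp: forked_def)
  then have "finite (forked ?V f)" using finite_configs finite_subset by blast
  from sparse_subset_functional_graph[OF this, of f] obtain I where I: "I \<subseteq> forked ?V f"
    "card (forked ?V f) \<le> 5 * card I"
    and indep: "\<And>x y. x \<in> I \<Longrightarrow> y \<in> I \<Longrightarrow> x \<noteq> y \<Longrightarrow> y \<noteq> f x \<and> y \<noteq> f (f x)"
    by blast
  have IV: "I \<subseteq> ?V" using I(1) by (auto simp: forked_def)
  then have finI: "finite I" using finite_configs finite_subset by blast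
  have "\<forall>v\<in>I. \<exists>a b u. a \<in> ?V \<and> b \<in> ?V \<and> u \<in> ?V \<and> f a = u \<and> f b = u \<and> f u = v
      \<and> distinct [a, b, u, v]"
    using I(1) unfolding forked_def by blast
  from bchoice[OF this] obtain A where "\<forall>v\<in>I. \<exists>b u. A v \<in> ?V \<and> b \<in> ?V \<and> u \<in> ?V
      \<and> f (A v) = u \<and> f b = u \<and> f u = v \<and> distinct [A v, b, u, v]" ..
  from bchoice[OF this] obtain B where "\<forall>v\<in>I. \<exists>u. A v \<in> ?V \<and> B v \<in> ?V \<and> u \<in> ?V
      \<and> f (A v) = u \<and> f (B v) = u \<and> f u = v \<and> distinct [A v, B v, u, v]" ..
  from bchoice[OF this] obtain U where ABU: "\<forall>v\<in>I. A v \<in> ?V \<and> B v \<in> ?V \<and> U v \<in> ?V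
      \<and> f (A v) = U v \<and> f (B v) = U v \<and> f (U v) = v \<and> distinct [A v, B v, U v, v]" ..
  have inV: "A v \<in> ?V" "B v \<in> ?V" "U v \<in> ?V"
    and fA: "f (A v) = U v" and fB: "f (B v) = U v" and fU: "f (U v) = v"
    and dist: "distinct [A v, B v, U v, v]" if "v \<in> I" for v
    using bspec[OF ABU that] by simp_all
  \<comment> \<open>\<open>P (v, s, t)\<close> is the point of the quadruple of \<open>v\<close>
    that is to become the corner with first two components \<open>s, t\<close>.\<close>
  define P where "P = (\<lambda>(v, s, t). if s then if t then v else A v else if t then B v else U v)"
  let ?Z = "I \<times> (UNIV :: (bool \<times> bool) set)"
  \<comment> \<open>A corner reaches its tip after 0, 1 or 2 applications of \<open>f\<close>. A
    common corner of two quadruples therefore makes the tips equal, or one of them the image of the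
    other under \<open>f\<close> or \<open>f o f\<close>.\<close>
  have same: "v = v'" if "v \<in> I" "v' \<in> I" "P (v, s, t) = P (v', s', t')" for v v' s t s' t'
  proof (rule ccontr)
    assume "v \<noteq> v'"
    then have "v' \<noteq> f v" "v' \<noteq> f (f v)" "v \<noteq> f v'" "v \<noteq> f (f v')"
      using indep[OF that(1,2)] indep[OF that(2,1)] by auto
    with that \<open>v \<noteq> v'\<close> show False
      using fA[of v] fB[of v] fU[of v] fA[of v'] fB[of v'] fU[of v']
      unfolding P_def by (simp split: if_splits; metis)
  qed
  have injP: "inj_on P ?Z"
  proof (rule inj_onI)
    fix z z' assume z: "z \<in> ?Z" "z' \<in> ?Z" "P z = P z'"
    obtain v s t v' s' t' where eq: "z = (v, s, t)" "z' = (v', s', t')"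
      by (metis prod.collapse)
    have "v = v'" using same z unfolding eq by blast
    moreover have "v \<in> I" using z eq by simp
    ultimately show "z = z'"
      using z(3) dist[of v] unfolding eq P_def by (auto split: if_splits)
  qed
  have PV: "P ` ?Z \<subseteq> ?V"
    using inV IV by (auto simp: P_def)
  \<comment> \<open>The quadruples are disjoint, so \<open>I\<close> has at most
    \<open>2 ^ (n - 2)\<close> elements and each tip can receive its own tail
    \<open>w v\<close>.\<close>
  have "card I * 4 = card ?Z"
    by (simp add: card_cartesian_product card_UNIV_bool flip: UNIV_Times_UNIV)
  also have "\<dots> \<le> card ?V"
    using card_inj_on_le[OF injP PV finite_configs] .
  also have "\<dots> = card (configs (n - 2)) * 4"
    using n by (auto simp: card_configs power_add dest!: le_Suc_ex)
  finally have "card I \<le> card (configs (n - 2))" by simp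
  then obtain w where w: "w ` I \<subseteq> configs (n - 2)" "inj_on w I"
    using card_le_inj[OF finI finite_configs] by blast
  define Q where "Q = (\<lambda>(v, s, t). s # t # w v)"
  have injQ: "inj_on Q ?Z" using w(2) by (auto simp: inj_on_def Q_def)
  have QV: "Q ` ?Z \<subseteq> ?V" using w(1) n by (auto simp: Q_def configs_def)
  obtain p where p: "bij_betw p ?V ?V" and pPQ: "\<And>z. z \<in> ?Z \<Longrightarrow> p (P z) = Q z"
    using bij_betw_extend[OF finite_configs injP injQ PV QV] by blast
  obtain h where h: "h \<in> boolean_networks n" "sync_equiv n h f"
    and hp: "\<And>x. x \<in> ?V \<Longrightarrow> h (p x) = p (f x)"
    using conjugate_network[OF f p] by blast
  have pv: "p (U v) = [False, False] @ w v" "p (A v) = [True, False] @ w v"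
    "p (B v) = [False, True] @ w v" "p v = [True, True] @ w v" if "v \<in> I" for v
    using that pPQ[of "(v, False, False)"] pPQ[of "(v, True, False)"]
      pPQ[of "(v, False, True)"] pPQ[of "(v, True, True)"] by (simp_all add: P_def Q_def)
  have hv: "h (False # False # w v) = True # True # w v"
    "h (True # False # w v) = False # False # w v"
    "h (False # True # w v) = False # False # w v" if "v \<in> I" for v
    using hp[of "U v"] hp[of "A v"] hp[of "B v"] inV fA fB fU pv that by simp_all
  \<comment> \<open>The tip's corner is left out because its image is uncontrolled. Although
    \<open>h\<close> maps the \<open>00\<close> corner to the \<open>11\<close> corner, an
    asynchronous step flips just one component and stays in \<open>X v\<close>.\<close>
  define X where "X v = {False # False # w v, True # False # w v, False # True # w v}" for v
  have "closed_set ?V (async_arcs n h) (X v)" if v: "v \<in> I" for v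
    unfolding closed_set_def
  proof (intro conjI notI)
    show "X v \<subseteq> ?V" using w(1) v n by (auto simp: X_def configs_def)
    assume "\<exists>x\<in>X v. \<exists>y\<in>?V - X v. (x, y) \<in> async_arcs n h"
    then show False
      using hv[OF v] by (auto simp: X_def dest!: async_arc_out_of_square)
  qed (simp add: X_def)
  moreover have "X v \<inter> X v' = {}" if "v \<in> I" "v' \<in> I" "v \<noteq> v'" for v v'
    using w(2) that by (auto simp: X_def inj_on_def)
  moreover have "card (X v) \<le> 4" for v
    by (simp add: X_def card_insert_if)
  ultimately have "card I \<le> card {X. is_attractor ?V (async_arcs n h) X \<and> card X \<le> 4}"
    by (intro card_attractors_ge[OF finite_configs])
  with I(2) h show ?thesis by (intro bexI[of _ h]) auto
qed

section \<open>Expected number of tips\<close>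

text \<open>Induction on \<open>S\<close>: a new value \<open>u\<close> is either not taken, or
  taken at exactly one \<open>a\<close>, leaving a map on \<open>A - {a}\<close>. So each value of
  \<open>S\<close> costs a factor \<open>1 + card A / card C\<close>. For \<open>A = C\<close> this
  is 2, the source of the Poisson probability \<open>2 / e\<close> of in-degree at most one.\<close>

lemma card_PiE_at_most_once_le:
  fixes C S :: "'b set"
  assumes "finite A" "finite C" "C \<noteq> {}" "finite S" "C \<inter> S = {}"
  shows "real (card {g \<in> A \<rightarrow>\<^sub>E C \<union> S. \<forall>u\<in>S. \<forall>a\<in>A. \<forall>b\<in>A. g a = u \<longrightarrow> g b = u \<longrightarrow> a = b})
    \<le> real (card C) ^ card A * (1 + card A / card C) ^ card S"
proof -
  define G where "G A S = {g \<in> A \<rightarrow>\<^sub>E C \<union> S. \<forall>u\<in>S. \<forall>a\<in>A. \<forall>b\<in>A. g a = u \<longrightarrow> g b = u \<longrightarrow> a = b}"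
    for A :: "'a set" and S
  define c where "c = real (card C)"
  have c: "c > 0" using assms by (simp add: c_def card_gt_0_iff)
  have fin: "finite (G A S)" if "finite A" "finite S" for A S
    using that assms(2) by (auto simp: G_def intro!: finite_subset[OF _ finite_PiE[of A "\<lambda>_. C \<union> S"]])
  have "real (card (G A S)) \<le> c ^ card A * (1 + card A / c) ^ card S"
    using assms(4,5,1)
  proof (induction S arbitrary: A rule: finite_induct)
    case empty
    then show ?case by (simp add: G_def card_PiE c_def)
  next
    case (insert u S)
    note finA = \<open>finite A\<close>
    let ?m = "real (card A)"
    have "G A (insert u S) \<subseteq> G A S \<union> (\<Union>a\<in>A. (\<lambda>g. g(a := u)) ` G (A - {a}) S)"
    proof
      fix g assume g: "g \<in> G A (insert u S)"
      show "g \<in> G A S \<union> (\<Union>a\<in>A. (\<lambda>g. g(a := u)) ` G (A - {a}) S)"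
      proof (cases "\<exists>a\<in>A. g a = u")
        case False
        then have "g \<in> G A S" using g by (fastforce simp: G_def PiE_iff)
        then show ?thesis by simp
      next
        case True
        then obtain a where a: "a \<in> A" "g a = u" by blast
        define g' where "g' = restrict g (A - {a})"
        have "g x = (g'(a := u)) x" for x
          using a g by (auto simp: g'_def G_def PiE_iff extensional_def)
        then have "g = g'(a := u)" by blast
        moreover have uniq: "g b \<noteq> u" if "b \<in> A - {a}" for b
          using a g that by (auto simp: G_def)
        have "g' \<in> A - {a} \<rightarrow>\<^sub>E C \<union> S"
        proof (rule PiE_I)
          fix x assume x: "x \<in> A - {a}"
          then have "g x \<in> C \<union> insert u S" using g by (auto simp: G_def)
          then show "g' x \<in> C \<union> S" using uniq[OF x] x by (auto simp: g'_def)
        qed (auto simp: g'_def)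
        then have "g' \<in> G (A - {a}) S"
          using g by (auto simp: G_def g'_def)
        ultimately show ?thesis using a by blast
      qed
    qed
    then have "card (G A (insert u S)) \<le> card (G A S \<union> (\<Union>a\<in>A. (\<lambda>g. g(a := u)) ` G (A - {a}) S))"
      using finA insert.hyps fin by (intro card_mono) auto
    also have "\<dots> \<le> card (G A S) + card (\<Union>a\<in>A. (\<lambda>g. g(a := u)) ` G (A - {a}) S)"
      by (rule card_Un_le)
    also have "\<dots> \<le> card (G A S) + (\<Sum>a\<in>A. card ((\<lambda>g. g(a := u)) ` G (A - {a}) S))"
      using finA by (intro add_left_mono card_UN_le)
    also have "\<dots> \<le> card (G A S) + (\<Sum>a\<in>A. card (G (A - {a}) S))"
      using finA insert.hyps fin by (intro add_left_mono sum_mono card_image_le) auto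
    finally have "real (card (G A (insert u S))) \<le> real (card (G A S)) + (\<Sum>a\<in>A. real (card (G (A - {a}) S)))"
      by (simp flip: of_nat_sum of_nat_add)
    also have "\<dots> \<le> c ^ card A * (1 + ?m / c) ^ card S
        + (\<Sum>a\<in>A. c ^ (card A - 1) * (1 + ?m / c) ^ card S)"
    proof (intro add_mono sum_mono)
      show "real (card (G A S)) \<le> c ^ card A * (1 + ?m / c) ^ card S"
        using insert by simp
      fix a assume a: "a \<in> A"
      have "real (card (G (A - {a}) S)) \<le> c ^ card (A - {a}) * (1 + card (A - {a}) / c) ^ card S"
        using insert by simp
      also have "\<dots> \<le> c ^ (card A - 1) * (1 + ?m / c) ^ card S"
        using a finA c by (intro mult_mono power_mono add_left_mono divide_right_mono) auto
      finally show "real (card (G (A - {a}) S)) \<le> c ^ (card A - 1) * (1 + ?m / c) ^ card S" .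
    qed
    also have "\<dots> = (c ^ card A + ?m * c ^ (card A - 1)) * (1 + ?m / c) ^ card S"
      by (simp add: algebra_simps)
    \<comment> \<open>For empty \<open>A\<close> the exponent \<open>card A - 1\<close> truncates,
      but then both sides vanish.\<close>
    also have "?m * c ^ (card A - 1) = c ^ card A * (?m / c)"
      using c by (cases "card A") auto
    also have "(c ^ card A + c ^ card A * (?m / c)) * (1 + ?m / c) ^ card S
        = c ^ card A * (1 + ?m / c) ^ card (insert u S)"
      using insert.hyps by (simp add: algebra_simps)
    finally show ?case .
  qed
  then show ?thesis by (simp add: G_def c_def)
qed

text \<open>Fix the set \<open>S\<close> of preimages of \<open>v\<close> other than
  \<open>v\<close>. The value at \<open>v\<close> is free, those on \<open>S\<close> are forced, and
  those on the \<open>M\<close> remaining points avoid \<open>v\<close>, which gives the first term.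
  If \<open>v\<close> is not a tip, no point of \<open>S\<close> has two preimages among the
  remaining points, which gives the subtracted term.\<close>

lemma card_forked_given_preimage_ge:
  fixes V :: "'a set"
  assumes V: "finite V" "v \<in> V" and S: "S \<subseteq> V - {v}" and M: "card V = Suc (M + card S)" "0 < M"
  shows "real (card V) * (real (card V - 1) ^ M - 2 ^ card S * real M ^ M)
    \<le> card {f \<in> V \<rightarrow>\<^sub>E V. {x \<in> V - {v}. f x = v} = S \<and> v \<in> forked V f}"
proof -
  define R where "R = V - {v} - S"
  have finS: "finite S" using S V finite_subset by blast
  have finR: "finite R" using V by (simp add: R_def)
  have VR: "V = insert v (S \<union> R)" "v \<notin> S" "v \<notin> R" "S \<inter> R = {}" using V S by (auto simp: R_def)
  have "card V = Suc (card S + card R)"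
    using VR finS finR by (simp add: card_Un_disjoint)
  then have cR: "card R = M" using M by simp
  define H where "H = {f \<in> V \<rightarrow>\<^sub>E V. {x \<in> V - {v}. f x = v} = S}"
  have HS: "f x = v" if "f \<in> H" "x \<in> S" for f x
  proof -
    have "{x \<in> V - {v}. f x = v} = S" using that(1) unfolding H_def by blast
    then show ?thesis using that(2) by blast
  qed
  have finF: "finite (V \<rightarrow>\<^sub>E V)" using V by (simp add: finite_PiE)
  then have finH: "finite H" by (simp add: H_def)
  have "H = PiE V (\<lambda>x. if x = v then V else if x \<in> S then {v} else V - {v})" (is "_ = PiE V ?T")
  proof (intro equalityI subsetI)
    fix f assume f: "f \<in> H"
    then have "f x \<in> ?T x" if "x \<in> V" for x
      using that by (auto simp: H_def)
    then show "f \<in> PiE V ?T" using f by (auto simp: H_def PiE_iff)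
  next
    fix f assume f: "f \<in> PiE V ?T"
    have val: "f x \<in> ?T x" if "x \<in> V" for x using f that by (rule PiE_mem)
    have "f x \<in> V" if "x \<in> V" for x
      using val[OF that] V by (auto split: if_splits)
    then have "f \<in> V \<rightarrow>\<^sub>E V" using f by (simp add: PiE_iff)
    moreover have "f x = v \<longleftrightarrow> x \<in> S" if "x \<in> V" "x \<noteq> v" for x
      using val[OF that(1)] that by (auto split: if_splits)
    then have "{x \<in> V - {v}. f x = v} = S" using S by auto
    ultimately show "f \<in> H" by (simp add: H_def)
  qed
  then have "card H = (\<Prod>x\<in>V. card (?T x))"
    using V by (simp add: card_PiE)
  also have "\<dots> = card V * ((\<Prod>x\<in>S. card (?T x)) * (\<Prod>x\<in>R. card (?T x)))"
    using finS finR VR(2-4) by (subst (1) VR(1)) (simp add: prod.union_disjoint)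
  also have "(\<Prod>x\<in>S. card (?T x)) = 1"
    using VR(2) by (intro prod.neutral) auto
  also have "(\<Prod>x\<in>R. card (?T x)) = (\<Prod>x\<in>R. card V - 1)"
    using VR V by (intro prod.cong) auto
  finally have cH: "card H = card V * (card V - 1) ^ M"
    by (simp add: cR)
  define B where "B = {g \<in> R \<rightarrow>\<^sub>E R \<union> S. \<forall>u\<in>S. \<forall>a\<in>R. \<forall>b\<in>R. g a = u \<longrightarrow> g b = u \<longrightarrow> a = b}"
  have finB: "finite B"
    using finR finS by (auto simp: B_def intro!: finite_subset[OF _ finite_PiE[of R "\<lambda>_. R \<union> S"]])
  have "R \<noteq> {}" using cR M by auto
  have "real (card B) \<le> real (card R) ^ card R * (1 + card R / card R) ^ card S"
    unfolding B_def using finR finS \<open>R \<noteq> {}\<close> VR(4)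
    by (intro card_PiE_at_most_once_le) auto
  then have cB: "real (card B) \<le> 2 ^ card S * real M ^ M"
    using M by (simp add: cR mult.commute)
  let ?bad = "{f \<in> H. v \<notin> forked V f}"
  \<comment> \<open>All maps in \<open>H\<close> agree on \<open>S\<close>, so \<open>r\<close>
    loses no information.\<close>
  define r where "r f = (f v, restrict f R)" for f :: "'a \<Rightarrow> 'a"
  have "inj_on r ?bad"
  proof (rule inj_onI)
    fix f g assume fg: "f \<in> ?bad" "g \<in> ?bad" "r f = r g"
    have "f x = g x" if "x \<in> V" for x
    proof -
      consider "x = v" | "x \<in> S" | "x \<in> R" using \<open>x \<in> V\<close> VR by blast
      then show ?thesis
      proof cases
        case 1
        then show ?thesis using fg(3) by (simp add: r_def)
      next
        case 2
        then show ?thesis using fg(1,2) HS[of f x] HS[of g x] by simp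
      next
        case 3
        have "restrict f R x = restrict g R x" using fg(3) by (simp add: r_def)
        with 3 show ?thesis by simp
      qed
    qed
    then show "f = g"
      using fg(1,2) by (intro PiE_ext[of f V "\<lambda>_. V" g]) (auto simp: H_def)
  qed
  moreover have "r ` ?bad \<subseteq> V \<times> B"
  proof
    fix z assume "z \<in> r ` ?bad"
    then obtain f where f: "f \<in> V \<rightarrow>\<^sub>E V" "{x \<in> V - {v}. f x = v} = S" "v \<notin> forked V f" "z = r f"
      unfolding H_def by blast
    have "f x \<in> R \<union> S" if "x \<in> R" for x
    proof -
      have "f x \<in> V" "f x \<noteq> v" using that f(1,2) unfolding R_def by blast+
      then show ?thesis using VR by blast
    qed
    then have "restrict f R \<in> R \<rightarrow>\<^sub>E R \<union> S" by auto
    moreover have "a = b" if "u \<in> S" "a \<in> R" "b \<in> R" "f a = u" "f b = u" for u a b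
    proof (rule ccontr)
      assume "a \<noteq> b"
      have "f u = v" "u \<in> V" "u \<noteq> v" using that(1) f(2) by blast+
      moreover have "a \<in> V" "b \<in> V" "a \<noteq> v" "b \<noteq> v" "a \<noteq> u" "b \<noteq> u" using that VR by auto
      ultimately have "v \<in> forked V f"
        unfolding forked_def using that \<open>a \<noteq> b\<close> V
        by (intro CollectI conjI bexI[of _ a] bexI[of _ b] bexI[of _ u]) auto
      with f(3) show False by simp
    qed
    ultimately have "restrict f R \<in> B" by (auto simp: B_def)
    then show "z \<in> V \<times> B" using f V by (auto simp: r_def)
  qed
  ultimately have "card ?bad \<le> card (V \<times> B)"
    using finB V by (intro card_inj_on_le) auto
  then have "real (card ?bad) \<le> real (card V) * real (card B)"
    by (simp add: card_cartesian_product flip: of_nat_mult)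
  also have "\<dots> \<le> real (card V) * (2 ^ card S * real M ^ M)"
    using cB by (intro mult_left_mono) auto
  finally have bad: "real (card ?bad) \<le> real (card V) * (2 ^ card S * real M ^ M)" .
  have "H = {f \<in> H. v \<in> forked V f} \<union> ?bad" by auto
  then have "card H = card {f \<in> H. v \<in> forked V f} + card ?bad"
    using finH by (subst card_Un_disjoint[symmetric]) (auto intro: arg_cong[where f = card])
  then have "real (card {f \<in> H. v \<in> forked V f}) = real (card H) - card ?bad" by simp
  moreover have "{f \<in> H. v \<in> forked V f} = {f \<in> V \<rightarrow>\<^sub>E V. {x \<in> V - {v}. f x = v} = S \<and> v \<in> forked V f}"
    by (auto simp: H_def)
  ultimately show ?thesis using bad cH by (simp add: right_diff_distrib)
qed

text \<open>The \<open>k\<close>-th summand is a lower bound for the probability that \<open>v\<close> has exactly \<open>k\<close> preimages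
  other than itself, one of which has two preimages itself. The limit misses the Poisson value only
  through the truncation at \<open>K\<close>.\<close>

definition fork_density :: "nat \<Rightarrow> nat \<Rightarrow> real" where
  "fork_density K N = (\<Sum>k\<le>K. real (N - 1 choose k)
     * (real (N - 1) ^ (N - 1 - k) - 2 ^ k * real (N - 1 - k) ^ (N - 1 - k)) / real N ^ (N - 1))"

text \<open>The maps are classified by the exact preimage set \<open>S\<close>, with
  \<open>N - 1 choose k\<close> sets of each size \<open>k\<close>. The assumption on
  \<open>K\<close> keeps \<open>M = N - 1 - k\<close> positive.\<close>

lemma card_forked_at_ge:
  assumes V: "finite V" "v \<in> V" and K: "Suc K < card V"
  shows "fork_density K (card V) * card (V \<rightarrow>\<^sub>E V) \<le> card {f \<in> V \<rightarrow>\<^sub>E V. v \<in> forked V f}"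
proof -
  define N where "N = card V"
  define D where "D k = {S. S \<subseteq> V - {v} \<and> card S = k}" for k
  define G where "G S = {f \<in> V \<rightarrow>\<^sub>E V. {x \<in> V - {v}. f x = v} = S \<and> v \<in> forked V f}" for S
  have finF: "finite (V \<rightarrow>\<^sub>E V)" using V by (simp add: finite_PiE)
  have N: "0 < N" using V by (auto simp: N_def card_gt_0_iff)
  have finD: "finite (D k)" for k
    using V by (auto simp: D_def intro!: finite_subset[OF _ finite_Pow_iff[THEN iffD2, of "V - {v}"]])
  have cD: "card (D k) = (N - 1 choose k)" for k
    using V n_subsets[of "V - {v}" k] by (simp add: D_def N_def)
  have "real (card (V \<rightarrow>\<^sub>E V)) = real N ^ N"
    using V by (simp add: card_PiE N_def)
  also have "\<dots> = real N * real N ^ (N - 1)"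
    using N by (simp flip: power_Suc)
  finally have cF: "real (card (V \<rightarrow>\<^sub>E V)) = real N * real N ^ (N - 1)" .
  have cancel: "x / real N ^ (N - 1) * (real N * real N ^ (N - 1)) = x * real N" for x
    using N by simp
  have "fork_density K N * card (V \<rightarrow>\<^sub>E V) = (\<Sum>k\<le>K. real (N - 1 choose k)
      * (real N * (real (N - 1) ^ (N - 1 - k) - 2 ^ k * real (N - 1 - k) ^ (N - 1 - k))))"
    unfolding fork_density_def cF sum_distrib_right cancel by (simp only: mult_ac)
  also have "\<dots> = (\<Sum>k\<le>K. \<Sum>S\<in>D k.
      real N * (real (N - 1) ^ (N - 1 - k) - 2 ^ k * real (N - 1 - k) ^ (N - 1 - k)))"
    by (simp add: cD)
  also have "\<dots> \<le> (\<Sum>k\<le>K. \<Sum>S\<in>D k. real (card (G S)))"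
  proof (intro sum_mono)
    fix k S assume "k \<in> {..K}" "S \<in> D k"
    then show "real N * (real (N - 1) ^ (N - 1 - k) - 2 ^ k * real (N - 1 - k) ^ (N - 1 - k))
        \<le> real (card (G S))"
      using card_forked_given_preimage_ge[OF V, of S "N - 1 - k"] K
      by (simp add: D_def G_def N_def)
  qed
  also have "\<dots> = (\<Sum>k\<le>K. real (card (\<Union>S\<in>D k. G S)))"
    using finD finF by (intro sum.cong refl, subst card_UN_disjoint) (auto simp: G_def)
  also have "\<dots> = real (card (\<Union>k\<le>K. \<Union>S\<in>D k. G S))"
    using finD finF by (subst card_UN_disjoint) (auto simp: G_def D_def)
  also have "\<dots> \<le> card {f \<in> V \<rightarrow>\<^sub>E V. v \<in> forked V f}"
    using finF by (intro of_nat_mono card_mono) (auto simp: G_def)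
  finally show ?thesis by (simp add: N_def)
qed

lemma sum_card_forked_ge:
  assumes "finite V" "Suc K < card V"
  shows "card V * fork_density K (card V) * card (V \<rightarrow>\<^sub>E V) \<le> (\<Sum>f\<in>V \<rightarrow>\<^sub>E V. real (card (forked V f)))"
proof -
  let ?F = "V \<rightarrow>\<^sub>E V"
  have fin: "finite ?F" using assms by (simp add: finite_PiE)
  have sub: "V \<inter> forked V f = forked V f" for f by (auto simp: forked_def)
  have "card V * fork_density K (card V) * card ?F
      = (\<Sum>v\<in>V. fork_density K (card V) * card ?F)"
    by simp
  also have "\<dots> \<le> (\<Sum>v\<in>V. real (card {f \<in> ?F. v \<in> forked V f}))"
    using assms by (intro sum_mono card_forked_at_ge)
  also have "\<dots> = (\<Sum>v\<in>V. \<Sum>f\<in>?F. if v \<in> forked V f then 1 else 0)"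
    using fin by (simp add: sum.If_cases Int_def)
  also have "\<dots> = (\<Sum>f\<in>?F. \<Sum>v\<in>V. if v \<in> forked V f then 1 else 0)"
    by (rule sum.swap)
  also have "\<dots> = (\<Sum>f\<in>?F. real (card (forked V f)))"
    using assms by (simp add: sum.If_cases sub)
  finally show ?thesis .
qed

section \<open>Asymptotics of the fork density\<close>

text \<open>The base tends to 1, so dropping a fixed number \<open>j\<close> of factors does not
  change the limit. Division by them is valid once the base is positive.\<close>

lemma tendsto_exp_limit_diff:
  "(\<lambda>N. (1 + x / real N) ^ (N - j)) \<longlonglongrightarrow> exp (x :: real)"
proof -
  have one: "(\<lambda>N. 1 + x / real N) \<longlonglongrightarrow> 1"
    using tendsto_add[OF tendsto_const lim_const_over_n[of x], of 1] by simp
  have "(\<lambda>N. (1 + x / real N) ^ N / (1 + x / real N) ^ j) \<longlonglongrightarrow> exp x / 1 ^ j"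
    using one by (intro tendsto_intros tendsto_exp_limit_sequentially) auto
  moreover have "\<forall>\<^sub>F N in sequentially. 0 < 1 + x / real N"
    using one by (rule order_tendstoD) simp
  then have "\<forall>\<^sub>F N in sequentially.
      (1 + x / real N) ^ N / (1 + x / real N) ^ j = (1 + x / real N) ^ (N - j)"
    using eventually_ge_at_top[of j] by eventually_elim (simp add: power_diff)
  ultimately show ?thesis by (simp add: filterlim_cong)
qed

lemma tendsto_choose_over_power:
  "(\<lambda>N. real (N - 1 choose k) / real N ^ k) \<longlonglongrightarrow> 1 / fact k"
proof -
  have "(\<lambda>N. (\<Prod>i=0..<k. 1 - (1 + real i) / real N) / fact k) \<longlonglongrightarrow> (\<Prod>i=0..<k. 1 - 0) / fact k"
    by (intro tendsto_intros lim_const_over_n) auto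
  moreover have "\<forall>\<^sub>F N in sequentially. (\<Prod>i=0..<k. 1 - (1 + real i) / real N) / fact k
      = real (N - 1 choose k) / real N ^ k"
    using eventually_gt_at_top[of 0]
  proof eventually_elim
    case (elim N)
    have "(\<Prod>i=0..<k. 1 - (1 + real i) / real N) = (\<Prod>i=0..<k. (real (N - 1) - real i) / real N)"
      using elim by (intro prod.cong) (auto simp: field_simps of_nat_diff)
    then show ?case
      by (simp add: binomial_gbinomial gbinomial_prod_rev prod_dividef)
  qed
  ultimately show ?thesis by (simp add: filterlim_cong)
qed

lemma fork_density_tendsto:
  "fork_density K \<longlonglongrightarrow> (\<Sum>k\<le>K. (exp (- 1) - 2 ^ k * exp (- real (Suc k))) / fact k)"
proof -
  have "(\<lambda>N. \<Sum>k\<le>K. real (N - 1 choose k) / real N ^ k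
      * ((1 + (- 1) / real N) ^ (N - Suc k) - 2 ^ k * (1 + (- real (Suc k)) / real N) ^ (N - Suc k)))
    \<longlonglongrightarrow> (\<Sum>k\<le>K. 1 / fact k * (exp (- 1) - 2 ^ k * exp (- real (Suc k))))"
    by (intro tendsto_intros tendsto_choose_over_power tendsto_exp_limit_diff)
  moreover have "\<forall>\<^sub>F N in sequentially. (\<Sum>k\<le>K. real (N - 1 choose k) / real N ^ k
      * ((1 + (- 1) / real N) ^ (N - Suc k) - 2 ^ k * (1 + (- real (Suc k)) / real N) ^ (N - Suc k)))
    = fork_density K N"
    using eventually_gt_at_top[of K]
  proof eventually_elim
    case (elim N)
    have "real (N - 1 choose k) / real N ^ k
        * ((1 + (- 1) / real N) ^ (N - Suc k) - 2 ^ k * (1 + (- real (Suc k)) / real N) ^ (N - Suc k))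
      = real (N - 1 choose k)
        * (real (N - 1) ^ (N - 1 - k) - 2 ^ k * real (N - 1 - k) ^ (N - 1 - k)) / real N ^ (N - 1)"
      if "k \<le> K" for k
    proof -
      have k: "N - 1 = k + (N - Suc k)" using elim that by auto
      have eqs: "1 + (- 1) / real N = real (N - 1) / real N"
        "1 + (- real (Suc k)) / real N = real (N - 1 - k) / real N"
        using elim that by (simp_all add: field_simps of_nat_diff)
      \<comment> \<open>The first factor normalises the binomial coefficient; the second turns the
        two powers into powers of \<open>1 - 1 / N\<close> and
        \<open>1 - (k + 1) / N\<close>.\<close>
      have "real N ^ (N - 1) = real N ^ k * real N ^ (N - 1 - k)"
        by (subst k) (simp add: power_add)
      moreover have "c / P * (A / Q - t * (B / Q)) = c * (A - t * B) / (P * Q)"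
        for c P A Q t B :: real
        by (simp add: diff_divide_distrib right_diff_distrib)
      moreover have "N - Suc k = N - 1 - k" by simp
      ultimately show ?thesis
        unfolding eqs by (simp only: power_divide)
    qed
    then show ?case unfolding fork_density_def by (intro sum.cong) auto
  qed
  ultimately show ?thesis by (simp add: filterlim_cong)
qed

text \<open>The truncated sum is about 0.2317; stopping at \<open>k = 4\<close> would give only
  0.2293, below the required 0.23.\<close>

lemma fork_density_limit_gt:
  "0.231 < (\<Sum>k\<le>5. (exp (- 1) - 2 ^ k * exp (- real (Suc k))) / fact k)"
proof -
  define q :: real where "q = exp (- 1)"
  have pow: "exp (- real (Suc k)) = q ^ Suc k" for k
    unfolding q_def by (metis exp_of_nat_mult mult_minus1_right)
  have e: "q * exp 1 = 1" by (simp add: q_def flip: exp_add)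
  have q0: "0 < q" by (simp add: q_def)
  \<comment> \<open>Bounds on \<open>exp 1\<close> become bounds on \<open>q\<close> through
    \<open>q * exp 1 = 1\<close>. The lower one serves the linear term of the polynomial in
    \<open>q\<close>; the higher powers have negative coefficients and need upper bounds
    only.\<close>
  have e_approx: "\<bar>exp 1 - 5837465777 / 2147483648\<bar> \<le> (1 / 4294967296 :: real)"
    using e_approx_32 by simp
  have "exp 1 \<le> (271829 / 100000 :: real)"
    using e_approx unfolding abs_le_iff by linarith
  from mult_left_mono[OF this, of q] have lo: "0.36787 \<le> q"
    using q0 e by simp
  have "(271828 / 100000 :: real) \<le> exp 1"
    using e_approx unfolding abs_le_iff by linarith
  from mult_left_mono[OF this, of q] have hi: "q \<le> 0.36789"
    using q0 e by simp
  have le: "q ^ k \<le> 0.36789 ^ k" for k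
    using hi q0 by (intro power_mono) auto
  have "(\<Sum>k\<le>5. (exp (- 1) - 2 ^ k * exp (- real (Suc k))) / fact k)
      = 103 / 60 * q - 2 * q ^ 2 - 2 * q ^ 3 - 4 / 3 * q ^ 4 - 2 / 3 * q ^ 5 - 4 / 15 * q ^ 6"
    unfolding pow q_def[symmetric] by (simp add: eval_nat_numeral fact_numeral field_simps)
  moreover have "q ^ 2 \<le> 135344 / 1000000" "q ^ 3 \<le> 49792 / 1000000" "q ^ 4 \<le> 18318 / 1000000"
    "q ^ 5 \<le> 6739 / 1000000" "q ^ 6 \<le> 2480 / 1000000"
    using le[of 2] le[of 3] le[of 4] le[of 5] le[of 6] by (simp_all add: power_divide)
  ultimately show ?thesis using lo by simp
qed

section \<open>Convergence of the probability\<close>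

theorem theorem4:
  "(\<lambda>n. measure_pmf.prob (pmf_of_set (boolean_networks n))
      {f. \<exists>h \<in> boolean_networks n. sync_equiv n h f \<and>
            0.046 * 2 ^ n \<le>
              real (card {X. is_attractor (configs n) (async_arcs n h) X \<and> card X \<le> 4})})
    \<longlonglongrightarrow> 1" (is "?prob \<longlonglongrightarrow> 1")
proof -
  have pow: "filterlim (\<lambda>n::nat. (2::nat) ^ n) at_top sequentially"
    by (rule filterlim_subseq) (simp add: strict_mono_def)
  have "\<forall>\<^sub>F N in sequentially. 0.231 < fork_density 5 N"
    using fork_density_tendsto fork_density_limit_gt by (rule order_tendstoD(1))
  then have density: "\<forall>\<^sub>F n in sequentially. 0.231 < fork_density 5 (2 ^ n)"
    using pow by (rule eventually_compose_filterlim)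
  \<comment> \<open>Chebyshev with Lipschitz constant 2 and deviation \<open>0.001 * 2 ^ n\<close>
    bounds the failure probability by \<open>4 * 2 ^ n / (0.001 * 2 ^ n)^2\<close>.\<close>
  have lower: "\<forall>\<^sub>F n in sequentially. 1 - 4000000 * (1 / 2) ^ n \<le> ?prob n"
    using density eventually_ge_at_top[of 3]
  proof eventually_elim
    case (elim n)
    let ?V = "configs n" and ?F = "boolean_networks n"
    let ?N = "(2::real) ^ n"
    let ?good = "{f. \<exists>h \<in> ?F. sync_equiv n h f \<and>
      0.046 * ?N \<le> real (card {X. is_attractor ?V (async_arcs n h) X \<and> card X \<le> 4})}"
    \<comment> \<open>The threshold is \<open>0.23 = 5 * 0.046\<close>, since a fifth of the tips
      yields attractors; the density bound 0.231 leaves the margin 0.001.\<close>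
    let ?low = "{f \<in> ?V \<rightarrow>\<^sub>E ?V. real (card (forked ?V f)) < 0.23 * ?N}"
    have F: "?F = ?V \<rightarrow>\<^sub>E ?V" by (simp add: boolean_networks_def)
    have ne: "?V \<noteq> {}" using card_configs[of n] by auto
    have cF: "0 < real (card ?F)"
      using finite_boolean_networks boolean_networks_nonempty by (simp add: card_gt_0_iff)
    \<comment> \<open>Truncation at \<open>K = 5\<close> requires more than six configurations,
      hence \<open>n\<close> at least 3.\<close>
    have "(2::nat) ^ 3 \<le> 2 ^ n" using elim by (intro power_increasing) auto
    then have "Suc 5 < card ?V" by (simp add: card_configs)
    then have "?N * fork_density 5 (2 ^ n) * card ?F \<le> (\<Sum>f\<in>?F. real (card (forked ?V f)))"
      using sum_card_forked_ge[OF finite_configs, of 5 n] by (simp add: card_configs F)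
    moreover have "(0.23 * ?N + 0.001 * ?N) * card ?F \<le> ?N * fork_density 5 (2 ^ n) * card ?F"
      using elim by (intro mult_right_mono) auto
    ultimately have mean: "(0.23 * ?N + 0.001 * ?N) * card (?V \<rightarrow>\<^sub>E ?V)
        \<le> (\<Sum>f\<in>?V \<rightarrow>\<^sub>E ?V. real (card (forked ?V f)))"
      unfolding F by (rule order_trans[rotated])
    have "card ?low * (0.001 * ?N)\<^sup>2 \<le> 2\<^sup>2 * card ?V * card (?V \<rightarrow>\<^sub>E ?V)"
      using low_tail_PiE_card_le[OF finite_configs finite_configs ne _ mean, of 2]
        card_forked_fun_upd[OF finite_configs] by simp
    then have "real (card ?low) * (?N * ?N / 1000000) \<le> 4 * ?N * card ?F"
      by (simp add: F card_configs power2_eq_square)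
    then have "real (card ?low) / card ?F \<le> 4000000 * (1 / 2) ^ n"
      using cF by (simp add: field_simps power_divide)
    moreover have "?F - ?low \<subseteq> ?F \<inter> ?good"
    proof
      fix f assume f: "f \<in> ?F - ?low"
      then have "0.23 * ?N \<le> card (forked ?V f)" by (auto simp: F)
      moreover obtain h where h: "h \<in> ?F" "sync_equiv n h f" and "card (forked ?V f)
          \<le> 5 * card {X. is_attractor ?V (async_arcs n h) X \<and> card X \<le> 4}"
        using exists_equivalent_many_attractors[of f n] f elim by auto
      then have "real (card (forked ?V f))
          \<le> 5 * real (card {X. is_attractor ?V (async_arcs n h) X \<and> card X \<le> 4})"
        by linarith
      ultimately have
        "0.046 * ?N \<le> real (card {X. is_attractor ?V (async_arcs n h) X \<and> card X \<le> 4})"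
        by simp
      then show "f \<in> ?F \<inter> ?good" using f h by blast
    qed
    then have "card (?F - ?low) \<le> card (?F \<inter> ?good)"
      using finite_boolean_networks by (intro card_mono) auto
    then have "real (card ?F) - card ?low \<le> card (?F \<inter> ?good)"
      by (subst (asm) card_Diff_subset)
        (auto simp: F finite_boolean_networks[of n, unfolded F] intro: finite_subset)
    then have "(real (card ?F) - card ?low) / card ?F \<le> card (?F \<inter> ?good) / card ?F"
      by (intro divide_right_mono) auto
    moreover have "?prob n = card (?F \<inter> ?good) / card ?F"
      by (rule measure_pmf_of_set[OF boolean_networks_nonempty finite_boolean_networks])
    ultimately show ?case using cF by (simp add: diff_divide_distrib)
  qed
  have "(\<lambda>n. 1 - 4000000 * (1 / 2) ^ n) \<longlonglongrightarrow> 1 - 4000000 * (0 :: real)"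
    by (intro tendsto_intros LIMSEQ_power_zero) auto
  then have lim: "(\<lambda>n. 1 - 4000000 * (1 / 2) ^ n) \<longlonglongrightarrow> (1 :: real)" by simp
  show ?thesis
    by (rule tendsto_sandwich[OF lower _ lim tendsto_const]) simp
qed

end
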